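(* Let $G$ be a $3$-regular equatorial graph with girth $5$ and equator $q$. Then $q\equiv 0\pmod 5$, and $G$ is isomorphic to $\mathcal{F}(3,5,q)$.
   Context: A cycle $C$ in $G$ is isometric if $d_C(x,y)=d_G(x,y)$ for all $x,y\in V(C)$; the equator is the length of a longest isometric cycle. An equatorial graph with girth $5$ and minimum degree $3$ is a finite graph with girth $5$, minimum degree $3$ and equator $q>15$ whose order is exactly $\frac{q}{5}\cdot 10=2q$ (in general: order $\frac{q}{g}M(\delta,g)$ with $q>6k+3$, $k=\lceil g/2\rceil-1$, where $M(3,5)=10$ is the Moore bound). For $q=5j$ with $j\ge 3$, $\mathcal{F}(3,5,q)$ is the graph obtained as follows: let $P$ be the Petersen graph and $uv$ an edge of $P$; take $j$ disjoint copies $F_1,\dots,F_j$ of $P-uv$, with $u_i,v_i$ the copies of $u,v$ in $F_i$, and add the edges $v_1u_2,v_2u_3,\dots,v_{j-1}u_j,v_ju_1$. *)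

theory Defs
  imports "Graph_Theory.Graph_Theory" "HOL-Number_Theory.Cong"
begin

text \<open>
  A finite simple graph is a \<open>pair_graph\<close>: a finite, loop-free, symmetric arc relation, so every
  edge \<open>xy\<close> is represented by the two arcs \<open>(x, y)\<close> and \<open>(y, x)\<close>.
\<close>

definition regular :: "nat \<Rightarrow> 'a pair_pre_digraph \<Rightarrow> bool" where
  "regular d G \<longleftrightarrow> (\<forall>x\<in>pverts G. out_degree (with_proj G) x = d)"

definition min_degree :: "'a pair_pre_digraph \<Rightarrow> nat" where
  "min_degree G = Min (out_degree (with_proj G) ` pverts G)"

definition graph_dist :: "'a pair_pre_digraph \<Rightarrow> 'a \<Rightarrow> 'a \<Rightarrow> ereal" where
  "graph_dist G x y = wf_digraph.\<mu> (with_proj G) (\<lambda>_. 1) x y"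

text \<open>
  The library's \<open>cycle\<close> is a directed notion, which also admits \<open>[(x, y), (y, x)]\<close> for every
  edge \<open>xy\<close>; the bound on the length excludes this case.
\<close>

definition graph_cycle :: "'a pair_pre_digraph \<Rightarrow> ('a \<times> 'a) awalk \<Rightarrow> bool" where
  "graph_cycle G C \<longleftrightarrow> pre_digraph.cycle (with_proj G) C \<and> 3 \<le> length C"

definition cycle_subgraph :: "('a \<times> 'a) awalk \<Rightarrow> 'a pair_pre_digraph" where
  "cycle_subgraph C = \<lparr> pverts = fst ` set C, parcs = set C \<union> (set C)\<inverse> \<rparr>"

definition isometric_cycle :: "'a pair_pre_digraph \<Rightarrow> ('a \<times> 'a) awalk \<Rightarrow> bool" where
  "isometric_cycle G C \<longleftrightarrow> graph_cycle G C \<and>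
     (\<forall>x\<in>pverts (cycle_subgraph C). \<forall>y\<in>pverts (cycle_subgraph C).
        graph_dist (cycle_subgraph C) x y = graph_dist G x y)"

definition girth :: "'a pair_pre_digraph \<Rightarrow> enat" where
  "girth G = (INF C\<in>{C. graph_cycle G C}. enat (length C))"

text \<open>The maximum exists in every finite graph that has a cycle, as shortest cycles are isometric.\<close>

definition equator :: "'a pair_pre_digraph \<Rightarrow> nat" where
  "equator G = Max (length ` {C. isometric_cycle G C})"

text \<open>
  Equatorial graphs of girth \<open>5\<close> and minimum degree \<open>3\<close>. In general the conditions on the equator
  and on the order are \<open>q > 6 * k + 3\<close>, where \<open>k = \<lceil>g / 2\<rceil> - 1\<close>, and \<open>q / g * M(\<delta>, g)\<close>;
  here \<open>k = 2\<close> and the Moore bound is \<open>M(3, 5) = 10\<close>.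
\<close>

definition equatorial_3_5 :: "'a pair_pre_digraph \<Rightarrow> bool" where
  "equatorial_3_5 G \<longleftrightarrow>
     pair_graph G \<and> girth G = 5 \<and> min_degree G = 3 \<and> equator G > 15 \<and>
     real (card (pverts G)) = real (equator G) / 5 * 10"

text \<open>The Petersen graph as the Kneser graph \<open>K(5, 2)\<close>.\<close>

definition petersen :: "nat set pair_pre_digraph" where
  "petersen =
     (let V = {A. A \<subseteq> {..<5} \<and> card A = 2}
      in \<lparr> pverts = V, parcs = {(A, B). A \<in> V \<and> B \<in> V \<and> A \<inter> B = {}} \<rparr>)"

text \<open>
  \<open>F_3_5 u v q\<close> is the graph \<open>\<F>(3, 5, q)\<close> built from the edge \<open>uv\<close> of the Petersen graph. It is
  meant for \<open>q = 5 * j\<close> with \<open>j \<ge> 3\<close>. The copies are indexed by \<open>0, \<dots>, j - 1\<close>.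
\<close>

definition F_3_5 :: "nat set \<Rightarrow> nat set \<Rightarrow> nat \<Rightarrow> (nat \<times> nat set) pair_pre_digraph" where
  "F_3_5 u v q =
     (let j = q div 5;
          copies = {((i, x), (i, y)) | i x y.
                      i < j \<and> (x, y) \<in> parcs petersen - {(u, v), (v, u)}};
          links = {((i, v), (Suc i mod j, u)) | i. i < j}
      in \<lparr> pverts = {..<j} \<times> pverts petersen, parcs = copies \<union> links \<union> links\<inverse> \<rparr>)"

end

theory Submission
  imports Defs
begin

text \<open>
  Let \<open>c i\<close>, for \<open>i\<close> modulo \<open>q\<close>, run through an isometric cycle of length \<open>q\<close>. By cubicity, every
  \<open>c i\<close> has exactly one neighbour \<open>d i\<close> off the cycle, and girth and isometry make the \<open>d i\<close> distinct.
  As the order is \<open>2 * q\<close>, there are no further vertices. By isometry and girth again, the two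
  remaining neighbours of \<open>d i\<close> have indices \<open>i + 2, i + 3\<close> (type R), or \<open>i - 2, i + 2\<close> (type M), or
  \<open>i - 3, i - 2\<close> (type L). Moreover \<open>d i, d (i + 2), d (i + 4), d (i + 6)\<close> is never a path, since it
  would give a walk of length \<open>5\<close> from \<open>c i\<close> to \<open>c (i + 6)\<close>. These local rules force the cyclic word
  of types to be a repetition of RRMLL. Hence \<open>5\<close> divides \<open>q\<close>, and the indices of a word RRMLL span
  a path and a pentagram joined by a matching, that is, a Petersen graph without one edge.
\<close>

section \<open>Walks, cycles and girth\<close>

text \<open>Passing from lists of arcs to powers of the arc relation leaves only the length of a
  walk to track. The condition on \<open>x\<close> matters at length 0, where the power relates
  every \<open>x\<close> to itself.\<close>

lemma (in pair_wf_digraph) awalk_iff_relpow: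
  "(\<exists>p. awalk x p y \<and> length p = n) \<longleftrightarrow> x \<in> pverts G \<and> (x, y) \<in> parcs G ^^ n"
proof (induction n arbitrary: x)
  case 0
  then show ?case by (auto simp: awalk_Nil_iff)
next
  case (Suc n)
  have "(\<exists>p. awalk x p y \<and> length p = Suc n) \<longleftrightarrow> (\<exists>z. (x, z) \<in> parcs G \<and> (\<exists>p. awalk z p y \<and> length p = n))"
  proof (intro iffI; elim exE conjE)
    fix p assume "awalk x p y" "length p = Suc n"
    then show "\<exists>z. (x, z) \<in> parcs G \<and> (\<exists>p. awalk z p y \<and> length p = n)"
      by (cases p) (simp, metis Suc_inject awalk_Cons_iff length_Cons prod.collapse)
  next
    fix z p assume "(x, z) \<in> parcs G" "awalk z p y" "length p = n"
    then have "awalk x ((x, z) # p) y \<and> length ((x, z) # p) = Suc n" by (simp add: awalk_Cons_iff)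
    then show "\<exists>p. awalk x p y \<and> length p = Suc n" by blast
  qed
  also have "\<dots> \<longleftrightarrow> x \<in> pverts G \<and> (\<exists>z. (x, z) \<in> parcs G \<and> (z, y) \<in> parcs G ^^ n)"
    unfolding Suc using wellformed' by blast
  also have "\<dots> \<longleftrightarrow> x \<in> pverts G \<and> (x, y) \<in> parcs G ^^ Suc n"
    by (meson relpow_Suc_E2 relpow_Suc_I2)
  finally show ?case .
qed

lemma graph_dist_eq:
  assumes "pair_wf_digraph H"
  shows "graph_dist H x y = (INF n\<in>{n. x \<in> pverts H \<and> (x, y) \<in> parcs H ^^ n}. ereal (real n))"
proof -
  interpret pair_wf_digraph H by fact
  have "awalk_cost (\<lambda>_. 1) p = real (length p)" for p
    by (induction p) auto
  moreover have "{n. x \<in> pverts H \<and> (x, y) \<in> parcs H ^^ n} = length ` {p. awalk x p y}"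
    unfolding awalk_iff_relpow[symmetric] by auto
  ultimately show ?thesis
    unfolding graph_dist_def \<mu>_def by (simp add: image_image)
qed

text \<open>Walk lengths are integers: if no walk had length at most \<open>n\<close>, the infimum
  would be at least \<open>n + 1\<close>.\<close>

lemma relpow_if_graph_dist_le:
  assumes "pair_wf_digraph H" "graph_dist H x y \<le> ereal (real n)"
  obtains m where "m \<le> n" "(x, y) \<in> parcs H ^^ m"
proof (rule ccontr)
  assume "\<not> thesis"
  with that have "m \<ge> Suc n" if "(x, y) \<in> parcs H ^^ m" for m
    using that not_less_eq_eq by blast
  then have "ereal (real (Suc n)) \<le> graph_dist H x y"
    unfolding graph_dist_eq[OF assms(1)] by (intro INF_greatest) (simp del: of_nat_Suc)
  then have "ereal (real (Suc n)) \<le> ereal (real n)" using assms(2) by (rule order_trans)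
  then show False by simp
qed

lemma graph_dist_le_if_relpow:
  assumes "pair_wf_digraph H" "x \<in> pverts H" "(x, y) \<in> parcs H ^^ n"
  shows "graph_dist H x y \<le> ereal (real n)"
  unfolding graph_dist_eq[OF assms(1)] using assms(2,3) by (intro INF_lower) simp

text \<open>Indexing the cycle by all integers, periodically, removes the wrap-around cases from
  later index arithmetic.\<close>

lemma graph_cycle_param:
  assumes G: "pair_wf_digraph G" and C: "graph_cycle G C"
  obtains c :: "int \<Rightarrow> 'a" where "\<And>i j. c i = c j \<longleftrightarrow> [i = j] (mod int (length C))"
    "set C = range (\<lambda>i. (c i, c (i + 1)))" "set C \<subseteq> parcs G" "fst ` set C = range c"
proof -
  interpret pair_wf_digraph G by fact
  let ?q = "length C"
  from C obtain u where u: "awalk u C u" "distinct (tl (awalk_verts u C))" "C \<noteq> []" and q: "?q \<ge> 3"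
    by (auto simp: graph_cycle_def cycle_def)
  then have cas: "cas u C u" and sub: "set C \<subseteq> parcs G" by auto
  have cas_nth: "cas x p y \<Longrightarrow> (p \<noteq> [] \<longrightarrow> fst (hd p) = x \<and> snd (last p) = y) \<and>
      (\<forall>i. Suc i < length p \<longrightarrow> snd (p ! i) = fst (p ! Suc i))" for x y and p :: "('a \<times> 'a) list"
    by (induction p arbitrary: x) (auto simp: nth_Cons hd_conv_nth split: nat.splits)
  have step: "snd (C ! i) = fst (C ! (Suc i mod ?q))" if "i < ?q" for i
  proof (cases "Suc i = ?q")
    case True
    then have "C ! i = last C" using u(3) by (metis diff_Suc_1 last_conv_nth)
    then show ?thesis using True cas_nth[OF cas] u(3) by (simp add: hd_conv_nth)
  next
    case False
    then show ?thesis using that cas_nth[OF cas] by simp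
  qed
  \<comment> \<open>A \<open>cycle\<close> comes with distinct heads. The list of heads is the list
    of tails rotated by one place, so the tails, which define \<open>c\<close>, are distinct
    too.\<close>
  have "distinct (map snd C)" using u(2) awalk_verts_conv'[OF cas] u(3) by simp
  moreover have "map snd C = rotate1 (map fst C)"
    by (rule nth_equalityI) (use u(3) in \<open>auto simp: nth_rotate1 step\<close>)
  ultimately have dist: "distinct (map fst C)" by simp
  define c where "c i = fst (C ! nat (i mod int ?q))" for i
  have "int ?q > 0" using q by linarith
  then have lt: "nat (i mod int ?q) < ?q" for i by (simp add: nat_less_iff)
  have c_eq: "c i = c j \<longleftrightarrow> [i = j] (mod int ?q)" for i j
    using nth_eq_iff_index_eq[OF dist, of "nat (i mod int ?q)" "nat (j mod int ?q)"] lt q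
      \<open>int ?q > 0\<close> by (simp add: c_def cong_def eq_nat_nat_iff)
  have c_nat: "c (int k) = fst (C ! k)" if "k < ?q" for k using that by (simp add: c_def)
  have nth_C: "C ! k = (c (int k), c (int k + 1))" if "k < ?q" for k
  proof -
    have "c (int k + 1) = c (int (Suc k mod ?q))"
      unfolding c_eq by (simp add: cong_def zmod_int add.commute)
    also have "\<dots> = fst (C ! (Suc k mod ?q))"
      by (rule c_nat, rule mod_less_divisor) (use that in linarith)
    also have "\<dots> = snd (C ! k)" using step[OF that] by simp
    finally show ?thesis using c_nat[OF that] by (simp add: prod_eq_iff)
  qed
  have "set C = range (\<lambda>i. (c i, c (i + 1)))"
  proof (rule equalityI; rule subsetI)
    fix e assume "e \<in> set C"
    then show "e \<in> range (\<lambda>i. (c i, c (i + 1)))" using nth_C by (auto simp: in_set_conv_nth)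
  next
    fix e assume "e \<in> range (\<lambda>i. (c i, c (i + 1)))"
    then obtain i where e: "e = (c i, c (i + 1))" by blast
    let ?k = "nat (i mod int ?q)"
    have "[i = int ?k] (mod int ?q)" using \<open>int ?q > 0\<close> by (simp add: cong_def)
    then have "e = C ! ?k" unfolding e nth_C[OF lt] by (simp add: c_eq cong_add_rcancel)
    then show "e \<in> set C" using lt nth_mem by metis
  qed
  moreover from this have "fst ` set C = range c" by (auto simp: image_image)
  ultimately show thesis using that c_eq sub by blast
qed

lemma cycle_subgraph_wf:
  assumes "set C = range (\<lambda>i::int. (c i, c (i + 1)))"
  shows "pair_wf_digraph (cycle_subgraph C)"
proof -
  have "fst e \<in> range c" "snd e \<in> range c" if "e \<in> set C" for e
    using that unfolding assms by auto
  moreover have "fst ` set C = range c" by (simp add: assms image_image)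
  ultimately show ?thesis by unfold_locales (auto simp: cycle_subgraph_def)
qed

text \<open>Each arc, in either direction, moves the index by one modulo \<open>q\<close>.\<close>

lemma cycle_subgraph_walk:
  fixes c :: "int \<Rightarrow> 'a"
  assumes C: "set C = range (\<lambda>i. (c i, c (i + 1)))" and c_eq: "\<And>i j. c i = c j \<longleftrightarrow> [i = j] (mod q)"
    and "(c i, y) \<in> parcs (cycle_subgraph C) ^^ n"
  shows "\<exists>t. \<bar>t\<bar> \<le> int n \<and> y = c (i + t)"
  using assms(3)
proof (induction n arbitrary: y)
  case 0
  then show ?case by auto
next
  case (Suc n)
  then obtain z where "(c i, z) \<in> parcs (cycle_subgraph C) ^^ n" and z: "(z, y) \<in> parcs (cycle_subgraph C)"
    by auto
  with Suc.IH obtain t where t: "\<bar>t\<bar> \<le> int n" "z = c (i + t)" by blast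
  obtain k where "z = c k \<and> y = c (k + 1) \<or> y = c k \<and> z = c (k + 1)"
    using z by (auto simp: cycle_subgraph_def C)
  then have "y = c (i + (t + 1)) \<or> y = c (i + (t - 1))"
  proof
    assume "z = c k \<and> y = c (k + 1)"
    then show ?thesis using t(2) by (auto simp: c_eq cong_iff_dvd_diff algebra_simps)
  next
    assume *: "y = c k \<and> z = c (k + 1)"
    then have "[k + 1 = i + t] (mod q)" using t(2) c_eq by metis
    then have "[k = i + (t - 1)] (mod q)" by (simp add: cong_iff_dvd_diff algebra_simps)
    then show ?thesis using * c_eq by metis
  qed
  moreover have "\<bar>t + 1\<bar> \<le> int (Suc n)" "\<bar>t - 1\<bar> \<le> int (Suc n)" using t(1) by auto
  ultimately show ?case by blast
qed

text \<open>The walk bounds the distance in \<open>G\<close>, isometry transfers the bound to the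
  cycle, and there a short walk moves the index only a little. Isometry enters the later arguments
  in this form.\<close>

lemma isometric_cycle_walk:
  fixes c :: "int \<Rightarrow> 'a"
  assumes G: "pair_wf_digraph G" and iso: "isometric_cycle G C"
    and C: "set C = range (\<lambda>i. (c i, c (i + 1)))" "fst ` set C = range c"
    and c_eq: "\<And>i j. c i = c j \<longleftrightarrow> [i = j] (mod q)"
    and walk: "(c i, c j) \<in> parcs G ^^ n"
  shows "\<exists>t. \<bar>t\<bar> \<le> int n \<and> [j = i + t] (mod q)"
proof -
  interpret pair_wf_digraph G by fact
  have wf: "pair_wf_digraph (cycle_subgraph C)" using C(1) by (rule cycle_subgraph_wf)
  have "set C \<subseteq> parcs G" using iso by (auto simp: isometric_cycle_def graph_cycle_def cycle_def)
  then have "c i \<in> pverts G" using C(1) wellformed' by blast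
  then have "graph_dist G (c i) (c j) \<le> ereal (real n)" using G walk by (intro graph_dist_le_if_relpow)
  moreover have "graph_dist (cycle_subgraph C) (c i) (c j) = graph_dist G (c i) (c j)"
    using iso C(2) by (auto simp: isometric_cycle_def cycle_subgraph_def)
  ultimately obtain m where "m \<le> n" "(c i, c j) \<in> parcs (cycle_subgraph C) ^^ m"
    using relpow_if_graph_dist_le[OF wf] by metis
  then obtain t where "\<bar>t\<bar> \<le> int m" "c j = c (i + t)"
    using cycle_subgraph_walk[OF C(1) c_eq] by blast
  with \<open>m \<le> n\<close> show ?thesis unfolding c_eq by (intro exI[of _ t]) simp
qed

section \<open>Girth, pentagons and the equator\<close>

lemma girth_le_length: "graph_cycle G C \<Longrightarrow> girth G \<le> enat (length C)"
  unfolding girth_def by (rule INF_lower) simp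

lemma girth_attained:
  assumes "girth G = enat g"
  obtains C where "graph_cycle G C" "length C = g"
proof (rule ccontr)
  assume "\<not> thesis"
  with that have "enat (Suc g) \<le> enat (length C)" if "graph_cycle G C" for C
    using girth_le_length[OF that] assms that by (metis Suc_leI enat_ord_simps(1) order_le_imp_less_or_eq)
  then have "enat (Suc g) \<le> girth G" unfolding girth_def by (intro INF_greatest) simp
  with assms show False by simp
qed

lemma girth_no_triangle:
  assumes "pair_graph G" "girth G > 3" "(x, y) \<in> parcs G" "(y, z) \<in> parcs G"
  shows "(z, x) \<notin> parcs G"
proof
  interpret pair_graph G by fact
  assume "(z, x) \<in> parcs G"
  then have "graph_cycle G [(x, y), (y, z), (z, x)]"
    using assms(3,4) no_loops' wellformed' unfolding graph_cycle_def cycle_def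
    by (auto simp: awalk_simps)
  from girth_le_length[OF this] assms(2) show False by (simp add: numeral_eq_enat eval_nat_numeral leD)
qed

text \<open>Without loops, consecutive vertices differ; if both pairs of opposite vertices differ as
  well, the closed walk is a genuine cycle of length 4.\<close>

lemma girth_no_square:
  assumes "pair_graph G" "girth G > 4" "(w, x) \<in> parcs G" "(x, y) \<in> parcs G" "(y, z) \<in> parcs G" "(z, w) \<in> parcs G"
  shows "w = y \<or> x = z"
proof (rule ccontr)
  interpret pair_graph G by fact
  assume "\<not> (w = y \<or> x = z)"
  then have "graph_cycle G [(w, x), (x, y), (y, z), (z, w)]"
    using assms(3-6) no_loops' wellformed' unfolding graph_cycle_def cycle_def
    by (auto simp: awalk_simps)
  from girth_le_length[OF this] assms(2) show False by (simp add: numeral_eq_enat eval_nat_numeral leD)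
qed

text \<open>Distances in a pentagon are at most 2, so a shortcut in \<open>G\<close> could only be
  one edge between vertices at distance 2, and it would close a triangle.\<close>

lemma isometric_5_cycle:
  assumes G: "pair_graph G" and girth: "girth G = 5" and C: "graph_cycle G C" "length C = 5"
  shows "isometric_cycle G C"
proof -
  interpret pair_graph G by fact
  obtain c where c_eq: "\<And>i j. c i = c j \<longleftrightarrow> [i = j] (mod int (length C))"
    and set_C: "set C = range (\<lambda>i. (c i, c (i + 1)))" and sub: "set C \<subseteq> parcs G"
    and verts_C: "fst ` set C = range c"
    by (rule graph_cycle_param[OF pair_wf_digraph C(1)]) (use that in blast)
  let ?H = "cycle_subgraph C"
  have wf: "pair_wf_digraph ?H" using set_C by (rule cycle_subgraph_wf)
  have step: "(c i, c (i + 1)) \<in> parcs ?H" and step': "(c i, c (i - 1)) \<in> parcs ?H" for i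
    by (auto simp: cycle_subgraph_def set_C image_iff)
  have H_sub: "parcs ?H \<subseteq> parcs G" using sub arcs_symmetric by (auto simp: cycle_subgraph_def)
  have "girth G > 3" using girth by simp
  note no_triangle = girth_no_triangle[OF G this]
  have "graph_dist ?H x y = graph_dist G x y" if xy: "x \<in> pverts ?H" "y \<in> pverts ?H" for x y
  proof (rule antisym)
    obtain i j where x: "x = c i" and y: "y = c j" using xy verts_C by (auto simp: cycle_subgraph_def)
    have inG: "x \<in> pverts G" using x step H_sub wellformed' by blast
    have mono: "parcs ?H ^^ n \<subseteq> parcs G ^^ n" for n
      by (induction n) (use H_sub in \<open>auto intro: relcompI\<close>)
    show "graph_dist G x y \<le> graph_dist ?H x y"
      unfolding graph_dist_eq[OF pair_wf_digraph] graph_dist_eq[OF wf]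
      using mono inG by (intro INF_superset_mono) auto
    show "graph_dist ?H x y \<le> graph_dist G x y"
      unfolding graph_dist_eq[OF pair_wf_digraph, of x y]
    proof (rule INF_greatest, clarify)
      fix n assume n: "(x, y) \<in> parcs G ^^ n"
      \<comment> \<open>The representative of \<open>j - i\<close> modulo 5 of least absolute value:
        the signed offset along the shorter side of the pentagon.\<close>
      define t where "t = (j - i + 2) mod 5 - 2"
      have "0 \<le> (j - i + 2) mod 5" "(j - i + 2) mod 5 < 5" by simp_all
      then have "t = 0 \<or> t = 1 \<or> t = -1 \<or> t = 2 \<or> t = -2" unfolding t_def by linarith
      moreover have "[j = i + t] (mod 5)" 
        unfolding t_def cong_iff_dvd_diff by presburger
      then have y': "y = c (i + t)" using y c_eq C(2) by simp
      ultimately have H: "(x, y) \<in> parcs ?H ^^ nat \<bar>t\<bar>"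
        using step[of i] step'[of i] relcompI[OF step[of i] step[of "i + 1"]]
          relcompI[OF step'[of i] step'[of "i - 1"]] x
        by (auto simp: numeral_2_eq_2 add.assoc)
      have "nat \<bar>t\<bar> \<le> n"
      proof (rule ccontr)
        assume "\<not> nat \<bar>t\<bar> \<le> n"
        moreover have "n \<noteq> 0" if "t \<noteq> 0"
        proof
          assume "n = 0"
          then have "int 5 dvd t" using n x y' C(2) c_eq[of i "i + t"] by (simp add: cong_iff_dvd_diff)
          with that \<open>t = 0 \<or> _\<close> show False by auto
        qed
        \<comment> \<open>A walk of length 0 forces \<open>t = 0\<close>, so the only possible
          shortcut is one edge against an offset of 2.\<close>
        ultimately have n1: "n = 1" and t2: "t = 2 \<or> t = -2"
          using \<open>t = 0 \<or> _\<close> by auto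
        then have "(y, x) \<in> parcs G" using n arcs_symmetric by simp
        then show False
          using t2 no_triangle[of x "c (i + 1)" y] no_triangle[of x "c (i - 1)" y] H_sub[THEN subsetD, OF step]
            H_sub[THEN subsetD, OF step[of "i + 1"]] H_sub[THEN subsetD, OF step']
            H_sub[THEN subsetD, OF step'[of "i - 1"]] x y' by (auto simp: add.assoc)
      qed
      then have "ereal (real (nat \<bar>t\<bar>)) \<le> ereal (real n)" by simp
      with graph_dist_le_if_relpow[OF wf xy(1) H] show "graph_dist ?H x y \<le> ereal (real n)"
        by (rule order_trans)
    qed
  qed
  then show ?thesis using C(1) by (simp add: isometric_cycle_def)
qed

text \<open>\<open>Max\<close> needs a finite nonempty set: the number of vertices bounds the length
  of a cycle, and a pentagon provides one isometric cycle.\<close>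

lemma equator_attained:
  assumes G: "pair_graph G" and girth: "girth G = 5"
  obtains C where "isometric_cycle G C" "length C = equator G"
proof -
  interpret pair_graph G by fact
  have "length C \<le> card (pverts G)" if "isometric_cycle G C" for C
  proof -
    from that obtain u where "awalk u C u" "distinct (tl (awalk_verts u C))" "C \<noteq> []"
      by (auto simp: isometric_cycle_def graph_cycle_def cycle_def)
    moreover from this have "cas u C u" "set C \<subseteq> parcs G" by auto
    ultimately have "distinct (map snd C)" "set (map snd C) \<subseteq> pverts G"
      using awalk_verts_conv'[of u C u] by (auto intro!: arc_snd_in_verts)
    then have "length (map snd C) \<le> card (pverts G)"
      by (metis card_mono distinct_card pair_finite_verts)
    then show ?thesis by simp
  qed
  then have "finite (length ` {C. isometric_cycle G C})"
    by (auto intro: finite_subset[of _ "{..card (pverts G)}"])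
  moreover obtain C where "graph_cycle G C" "length C = 5"
    using girth_attained[of G 5] girth by (auto simp: numeral_eq_enat)
  then have "isometric_cycle G C" using isometric_5_cycle[OF G girth] by blast
  ultimately have "equator G \<in> length ` {C. isometric_cycle G C}"
    unfolding equator_def by (intro Max_in) auto
  then show thesis using that by auto
qed

lemma out_degree_with_proj: "out_degree (with_proj G) x = card {y. (x, y) \<in> parcs G}"
proof -
  have "out_arcs (with_proj G) x = Pair x ` {y. (x, y) \<in> parcs G}"
    by (auto simp: out_arcs_def)
  then show ?thesis by (simp add: out_degree_def card_image inj_on_def)
qed

section \<open>The cyclic word of types\<close>

text \<open>\<open>E i\<close> and \<open>F i\<close> stand for edges from \<open>d i\<close> to
  \<open>d (i + 2)\<close> and to \<open>d (i + 3)\<close>; the alternatives in \<open>types\<close>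
  are R, M, L in this order. An index \<open>m\<close> with \<open>E (m - 2)\<close> and
  \<open>E m\<close> has type M and is the centre of a block RRMLL; the last two conjuncts make
  \<open>m + 5\<close> the next centre.\<close>

lemma block_pattern:
  fixes E F :: "int \<Rightarrow> bool"
  assumes types: "\<And>i. E i \<and> F i \<and> \<not> E (i - 2) \<and> \<not> F (i - 3)
      \<or> E i \<and> E (i - 2) \<and> \<not> F i \<and> \<not> F (i - 3)
      \<or> E (i - 2) \<and> F (i - 3) \<and> \<not> E i \<and> \<not> F i"
    and no_run: "\<And>i. \<not> (E i \<and> E (i + 2) \<and> E (i + 4))"
  shows "\<exists>m. E (m - 2) \<and> E m"
    and "E (m - 2) \<Longrightarrow> E m \<Longrightarrow> F (m - 2) \<and> F (m - 1) \<and> E (m - 1) \<and> \<not> F m \<and> \<not> E (m + 1)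
      \<and> \<not> F (m + 1) \<and> \<not> E (m + 2) \<and> \<not> F (m + 2) \<and> E (m + 3) \<and> E (m + 5)"
proof -
  \<comment> \<open>Without type M, \<open>E\<close> and \<open>F\<close> agree, and
    \<open>E i\<close> differs from both \<open>E (i - 2)\<close> and \<open>E (i - 3)\<close>. The
    latter two would then always be equal, so \<open>E\<close> would be constant, a
    contradiction.\<close>
  show "\<exists>m. E (m - 2) \<and> E m"
    using types[of 0] types[of 1] types[of 2] types[of 3] types[of 4] types[of 5]
      types[of "-1"] types[of "-2"] types[of "-3"] types[of "-4"]
    by simp smt
next
  \<comment> \<open>By \<open>no_run\<close>, \<open>E (m - 4)\<close> and \<open>E (m + 2)\<close>
    fail, so \<open>m - 2\<close> has type R and \<open>m + 2\<close> type L. Hence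
    \<open>F (m - 2)\<close> and \<open>F (m - 1)\<close> hold, which makes \<open>m + 1\<close> an
    L and \<open>m - 1\<close> an R. As \<open>E (m + 1)\<close> fails, \<open>m + 3\<close> is an
    R; with \<open>F (m + 2)\<close> false, \<open>m + 5\<close> can only be an M.\<close>
  assume *: "E (m - 2)" "E m"
  have t: "E (m + i) \<and> F (m + i) \<and> \<not> E (m + (i - 2)) \<and> \<not> F (m + (i - 3))
      \<or> E (m + i) \<and> E (m + (i - 2)) \<and> \<not> F (m + i) \<and> \<not> F (m + (i - 3))
      \<or> E (m + (i - 2)) \<and> F (m + (i - 3)) \<and> \<not> E (m + i) \<and> \<not> F (m + i)" for i
    using types[of "m + i"] by (simp add: algebra_simps)
  have n: "\<not> (E (m + i) \<and> E (m + (i + 2)) \<and> E (m + (i + 4)))" for i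
    using no_run[of "m + i"] by (simp add: algebra_simps)
  show "F (m - 2) \<and> F (m - 1) \<and> E (m - 1) \<and> \<not> F m \<and> \<not> E (m + 1)
      \<and> \<not> F (m + 1) \<and> \<not> E (m + 2) \<and> \<not> F (m + 2) \<and> E (m + 3) \<and> E (m + 5)"
    using * t[of 0] t[of 1] t[of 2] t[of 3] t[of 4] t[of 5] t[of 6] t[of 7] t[of 8]
      t[of "-1"] t[of "-2"] t[of "-3"] t[of "-4"]
      n[of 0] n[of 1] n[of 2] n[of 3] n[of 4] n[of 5] n[of "-1"] n[of "-2"] n[of "-3"] n[of "-4"]
    by simp
qed

lemma periodic_block_pattern:
  fixes E F :: "int \<Rightarrow> bool" and q :: nat
  assumes types: "\<And>i. E i \<and> F i \<and> \<not> E (i - 2) \<and> \<not> F (i - 3)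
      \<or> E i \<and> E (i - 2) \<and> \<not> F i \<and> \<not> F (i - 3)
      \<or> E (i - 2) \<and> F (i - 3) \<and> \<not> E i \<and> \<not> F i"
    and no_run: "\<And>i. \<not> (E i \<and> E (i + 2) \<and> E (i + 4))"
    and periodic: "\<And>i j. [i = j] (mod int q) \<Longrightarrow> E i = E j"
    and "q > 0"
  obtains m where "\<And>i. E (m + i) \<longleftrightarrow> i mod 5 \<le> 2" and "\<And>i. F (m + i) \<longleftrightarrow> i mod 5 \<le> 1"
    and "5 dvd q"
proof -
  note pat = block_pattern[of E F, OF types no_run]
  obtain m0 where m0: "E (m0 - 2)" "E m0" using pat(1) by blast
  \<comment> \<open>The first R of a block: the offsets 0 to 4 from \<open>m\<close> carry R, R, M,
    L, L.\<close>
  define m where "m = m0 - 2"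
  have up: "E (m + 5 * int k) \<and> E (m + 5 * int k + 2)" for k
  proof (induction k)
    case 0
    then show ?case using m0 by (simp add: m_def)
  next
    case (Suc k)
    then show ?case using pat(2)[of "m + 5 * int k + 2"] by (simp add: algebra_simps)
  qed
  have centre: "E (m + 5 * k) \<and> E (m + 5 * k + 2)" for k :: int
  proof -
    \<comment> \<open>Blocks propagate only to the right. Adding a multiple of \<open>q\<close> to
      \<open>k\<close> gives a nonnegative number, and periodicity carries the conclusion back to
      negative \<open>k\<close>.\<close>
    define l where "l = nat (k + int q * \<bar>k\<bar>)"
    have "- k \<le> 1 * \<bar>k\<bar>" by simp
    also have "\<dots> \<le> int q * \<bar>k\<bar>" using \<open>q > 0\<close> by (intro mult_right_mono) auto
    finally have l: "int l = k + int q * \<bar>k\<bar>" by (simp add: l_def)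
    have c: "[m + 5 * k + s = m + 5 * int l + s] (mod int q)" for s
      unfolding l by (simp add: cong_iff_dvd_diff algebra_simps)
    show ?thesis using up[of l] periodic[OF c[of 0]] periodic[OF c[of 2]] by simp
  qed
  have E: "E (m + i) \<longleftrightarrow> i mod 5 \<le> 2" and F: "F (m + i) \<longleftrightarrow> i mod 5 \<le> 1" for i
  proof -
    define k where "k = i div 5"
    have "i mod 5 = i - 5 * k" by (simp add: k_def minus_mult_div_eq_mod)
    then have "0 \<le> i - 5 * k" "i - 5 * k < 5" by (metis pos_mod_sign pos_mod_bound zero_less_numeral)+
    then have r: "i = 5 * k \<or> i = 5 * k + 1 \<or> i = 5 * k + 2 \<or> i = 5 * k + 3 \<or> i = 5 * k + 4"
      by linarith
    have "E (m + 5 * k)" "E (m + 5 * k + 2)" using centre by auto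
    with pat(2)[of "m + 5 * k + 2"]
    have "E (m + 5 * k)" "E (m + 5 * k + 1)" "E (m + 5 * k + 2)" "\<not> E (m + 5 * k + 3)" "\<not> E (m + 5 * k + 4)"
      "F (m + 5 * k)" "F (m + 5 * k + 1)" "\<not> F (m + 5 * k + 2)" "\<not> F (m + 5 * k + 3)" "\<not> F (m + 5 * k + 4)"
      by (simp_all add: algebra_simps)
    with r show "E (m + i) \<longleftrightarrow> i mod 5 \<le> 2" "F (m + i) \<longleftrightarrow> i mod 5 \<le> 1"
      by (auto simp: add.assoc)
  qed
  \<comment> \<open>The residues 0, 1, 2 modulo 5, where \<open>E\<close> holds, are invariant under
    adding \<open>q\<close>. The image of 0 leaves only 0, 1, 2 for \<open>q\<close> modulo 5, and
    the image of 2 excludes 1 and 2.\<close>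
  have "E (m + (i + int q)) = E (m + i)" for i
    by (rule periodic) (simp add: cong_iff_dvd_diff)
  then have "(i + int q) mod 5 \<le> 2 \<longleftrightarrow> i mod 5 \<le> 2" for i
    using E by blast
  from this[of 0] this[of 2] have "int q mod 5 \<le> 2" "(2 + int q mod 5) mod 5 \<le> 2"
    by (simp_all add: mod_simps)
  moreover have "int q mod 5 \<ge> 0" by simp
  ultimately have "int q mod 5 = 0 \<or> int q mod 5 = 1 \<or> int q mod 5 = 2" by linarith
  with \<open>(2 + int q mod 5) mod 5 \<le> 2\<close> have "int q mod 5 = 0" by auto
  then have "5 dvd q" by presburger
  with E F show thesis using that by blast
qed

section \<open>A cubic graph of order \<open>2 * q\<close> around an isometric cycle of length
  \<open>q\<close>\<close>

locale cubic_isometric_cycle =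
  fixes V :: "'a set" and A :: "'a rel" and c :: "int \<Rightarrow> 'a" and q :: nat
  assumes finite_V: "finite V" and card_V: "card V = 2 * q" and q_large: "q > 15"
    and A_subset: "A \<subseteq> V \<times> V" and A_sym: "(x, y) \<in> A \<Longrightarrow> (y, x) \<in> A" and no_loop: "(x, x) \<notin> A"
    and no_triangle: "(x, y) \<in> A \<Longrightarrow> (y, z) \<in> A \<Longrightarrow> (z, x) \<notin> A"
    and no_square: "(w, x) \<in> A \<Longrightarrow> (x, y) \<in> A \<Longrightarrow> (y, z) \<in> A \<Longrightarrow> (z, w) \<in> A \<Longrightarrow> w = y \<or> x = z"
    and cubic: "x \<in> V \<Longrightarrow> card {y. (x, y) \<in> A} = 3"
    and c_eq_iff: "c i = c j \<longleftrightarrow> [i = j] (mod int q)"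
    and c_step: "(c i, c (i + 1)) \<in> A"
    and c_isometric: "(c i, c j) \<in> A ^^ n \<Longrightarrow> \<exists>t. \<bar>t\<bar> \<le> int n \<and> [j = i + t] (mod int q)"
begin

text \<open>A nonzero multiple of \<open>q\<close> exceeds 15 in absolute value, so small index
  offsets can be compared as integers. The lower bound on the equator enters the local arguments
  here.\<close>

lemma c_eq_shift: "\<bar>s\<bar> \<le> 15 \<Longrightarrow> c (i + s) = c i \<longleftrightarrow> s = 0"
proof
  assume "\<bar>s\<bar> \<le> 15" "c (i + s) = c i"
  then have "int q dvd s" by (simp add: c_eq_iff cong_iff_dvd_diff)
  then show "s = 0" using \<open>\<bar>s\<bar> \<le> 15\<close> q_large by (cases "s = 0") (auto dest!: dvd_imp_le_int)
qed auto

text \<open>Isometry gives an offset \<open>t\<close> congruent to \<open>s\<close> with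
  \<open>\<bar>t\<bar> \<le> n\<close>. The bound 15 rules out going around the cycle, so
  \<open>s = t\<close>.\<close>

lemma short_walk:
  assumes "(c i, c (i + s)) \<in> A ^^ n" "\<bar>s\<bar> + int n \<le> 15"
  shows "\<bar>s\<bar> \<le> int n"
proof -
  obtain t where t: "\<bar>t\<bar> \<le> int n" "[i + s = i + t] (mod int q)" using c_isometric assms(1) by blast
  then have "c ((i + t) + (s - t)) = c (i + t)" by (simp add: c_eq_iff)
  then have "s - t = 0" using c_eq_shift[of "s - t" "i + t"] assms(2) t(1) by linarith
  then show ?thesis using t(1) by simp
qed

lemma c_in_V: "c i \<in> V"
  using c_step A_subset by blast

lemma c_step': "(c i, c (i - 1)) \<in> A"
  using A_sym[OF c_step[of "i - 1"]] by simp

definition d :: "int \<Rightarrow> 'a" where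
  "d i = (THE x. (c i, x) \<in> A \<and> x \<noteq> c (i - 1) \<and> x \<noteq> c (i + 1))"

lemma
  shows nbrs_c: "{y. (c i, y) \<in> A} = {c (i - 1), c (i + 1), d i}"
    and d_neq: "d i \<noteq> c (i - 1)" "d i \<noteq> c (i + 1)"
proof -
  let ?N = "{y. (c i, y) \<in> A}"
  have card: "card ?N = 3" using cubic c_in_V by blast
  have ne: "c (i - 1) \<noteq> c (i + 1)" using c_eq_shift[of 2 "i - 1"] by (auto simp: algebra_simps)
  have sub: "{c (i - 1), c (i + 1)} \<subseteq> ?N" using c_step c_step' by blast
  have "card (?N - {c (i - 1), c (i + 1)}) = 1"
    using card ne sub by (subst card_Diff_subset) auto
  then obtain x where x: "?N - {c (i - 1), c (i + 1)} = {x}" by (auto simp: card_1_singleton_iff)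
  then have "d i = x" unfolding d_def by (intro the_equality) auto
  with x sub show "?N = {c (i - 1), c (i + 1), d i}" "d i \<noteq> c (i - 1)" "d i \<noteq> c (i + 1)"
    by blast+
qed

lemma nbr_c_iff: "(c i, y) \<in> A \<longleftrightarrow> y = c (i - 1) \<or> y = c (i + 1) \<or> y = d i"
  using nbrs_c[of i] by (auto simp: set_eq_iff)

lemma c_d: "(c i, d i) \<in> A" and d_c: "(d i, c i) \<in> A"
  using A_sym by (auto simp: nbr_c_iff)

lemma d_cong: "[i = j] (mod int q) \<Longrightarrow> d i = d j"
proof -
  assume "[i = j] (mod int q)"
  then have "[i + s = j + s] (mod int q)" for s by (simp add: cong_add_rcancel)
  from this[of 0] this[of 1] this[of "-1"]
  have "c i = c j" "c (i + 1) = c (j + 1)" "c (i - 1) = c (j - 1)" by (simp_all add: c_eq_iff)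
  then show ?thesis by (simp add: d_def)
qed

text \<open>The cycle has no chord: one edge moves the index by at most one, offset 0 would be a
  loop, and the offsets 1 and -1 are excluded by the choice of \<open>d i\<close>.\<close>

lemma d_neq_c: "d i \<noteq> c j"
proof
  assume *: "d i = c j"
  then have "(c i, c j) \<in> A ^^ 1" using c_d[of i] by simp
  then obtain t where "\<bar>t\<bar> \<le> 1" "[j = i + t] (mod int q)" using c_isometric[of i j 1] by auto
  then have "c j = c (i + t)" "t = 0 \<or> t = 1 \<or> t = -1" by (auto simp: c_eq_iff)
  then show False using * c_d[of i] no_loop d_neq[of i] by auto
qed

text \<open>A common off-cycle neighbour joins two cycle vertices by a walk of length 2, so their
  indices differ by at most 2. Difference 1 would close a triangle and difference 2 a
  square.\<close>

lemma d_eq_iff: "d i = d j \<longleftrightarrow> [i = j] (mod int q)"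
proof
  have 1: "d i \<noteq> d (i + 1)" for i
    using no_triangle[OF c_step[of i] c_d[of "i + 1"]] d_c[of i] by metis
  have 2: "d i \<noteq> d (i + 2)" for i
  proof
    assume "d i = d (i + 2)"
    then have "(c (i + 2), d i) \<in> A" using c_d by metis
    then have "c i = c (i + 2) \<or> c (i + 1) = d i"
      using no_square[OF c_step[of i] _ _ d_c] c_step[of "i + 1"] by (simp add: add.assoc)
    then show False using d_neq_c[of i "i + 1"] c_eq_shift[of 2 i] by auto
  qed
  assume *: "d i = d j"
  then have "(c i, c j) \<in> A ^^ 2"
    using c_d[of i] d_c[of j] by (auto simp: numeral_2_eq_2)
  then obtain t where t: "\<bar>t\<bar> \<le> 2" "[j = i + t] (mod int q)" using c_isometric by force
  then have "d i = d (i + t)" using * d_cong by metis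
  moreover have "t = 0 \<or> t = 1 \<or> t = 2 \<or> t = -1 \<or> t = -2" using t(1) by auto
  ultimately have "t = 0" using 1[of i] 1[of "i - 1"] 2[of i] 2[of "i - 2"] by auto
  then show "[i = j] (mod int q)" using t(2) by (simp add: cong_sym)
qed (rule d_cong)

lemma d_in_V: "d i \<in> V"
  using c_d A_subset by blast

text \<open>One period of indices yields \<open>q\<close> vertices on the cycle and \<open>q\<close>
  others, which exhausts the order \<open>2 * q\<close>.\<close>

lemma V_eq: "V = range c \<union> range d"
proof -
  let ?I = "{0..<int q}"
  have "inj_on c ?I" "inj_on d ?I"
    by (auto simp: inj_on_def c_eq_iff d_eq_iff cong_def)
  then have "card (c ` ?I \<union> d ` ?I) = 2 * q"
    using d_neq_c by (subst card_Un_disjoint) (auto simp: card_image, metis)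
  then have "c ` ?I \<union> d ` ?I = V"
    using c_in_V d_in_V finite_V card_V by (intro card_subset_eq) auto
  then show ?thesis using c_in_V d_in_V by blast
qed

text \<open>Extending the walk by the edges to \<open>c i\<close> and \<open>c (i + s)\<close> adds
  2 to its length, whence 13 in place of the 15 of \<open>short_walk\<close>.\<close>

lemma d_walk:
  assumes "(d i, d (i + s)) \<in> A ^^ n" "\<bar>s\<bar> + int n \<le> 13"
  shows "\<bar>s\<bar> \<le> int n + 2"
proof -
  have "(c i, c (i + s)) \<in> A ^^ Suc (Suc n)"
    using relpow_Suc_I2[OF c_d relpow_Suc_I[OF assms(1) d_c]] .
  from short_walk[OF this] assms(2) show ?thesis by simp
qed

text \<open>An edge between \<open>d i\<close> and \<open>d j\<close> gives a walk of length 3 from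
  \<open>c i\<close> to \<open>c j\<close>, so the offset is at most 3. Offset 0 is a loop, and the
  offsets 1 and -1 close a square with a cycle edge.\<close>

lemma nbrs_d_subset:
  assumes "(d i, y) \<in> A"
  shows "y \<in> {c i, d (i - 3), d (i - 2), d (i + 2), d (i + 3)}"
proof -
  have 1: "(d i, d (i + 1)) \<notin> A" for i
  proof
    assume "(d i, d (i + 1)) \<in> A"
    then have "c i = d (i + 1) \<or> d i = c (i + 1)"
      using no_square[OF c_d _ d_c] c_step' by (metis add_diff_cancel_right')
    then show False using d_neq_c by metis
  qed
  have "y \<in> V" using assms A_subset by blast
  then consider j where "y = c j" | j where "y = d j" using V_eq by blast
  then show ?thesis
  proof cases
    case 1
    then have "d i = d j" using A_sym[OF assms] d_neq_c by (auto simp: nbr_c_iff)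
    then show ?thesis using 1 by (simp add: d_eq_iff c_eq_iff cong_sym)
  next
    case 2
    then have "(c i, c j) \<in> A ^^ 3"
      using c_d[of i] assms d_c[of j] by (auto simp: numeral_3_eq_3)
    then obtain t where t: "\<bar>t\<bar> \<le> 3" "[j = i + t] (mod int q)" using c_isometric by force
    then have y: "y = d (i + t)" using 2 d_cong by metis
    have "t = 0 \<or> t = 1 \<or> t = 2 \<or> t = 3 \<or> t = -1 \<or> t = -2 \<or> t = -3" using t(1) by auto
    moreover have "t \<noteq> 0" "t \<noteq> 1" "t \<noteq> -1"
      using assms y no_loop 1[of i] 1[of "i - 1"] A_sym by auto
    ultimately show ?thesis using y by auto
  qed
qed

text \<open>Edges among the \<open>d i\<close> are recorded at their left ends, separately for the
  two possible offsets 2 and 3.\<close>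

definition E :: "int \<Rightarrow> bool" where "E i \<longleftrightarrow> (d i, d (i + 2)) \<in> A"
definition F :: "int \<Rightarrow> bool" where "F i \<longleftrightarrow> (d i, d (i + 3)) \<in> A"

lemma E_back: "E (i - 2) \<longleftrightarrow> (d i, d (i - 2)) \<in> A"
  and F_back: "F (i - 3) \<longleftrightarrow> (d i, d (i - 3)) \<in> A"
  using A_sym by (auto simp: E_def F_def)

lemma nbrs_d:
  "{y. (d i, y) \<in> A} = {c i} \<union> (if F (i - 3) then {d (i - 3)} else {})
    \<union> (if E (i - 2) then {d (i - 2)} else {}) \<union> (if E i then {d (i + 2)} else {}) \<union> (if F i then {d (i + 3)} else {})"
  using nbrs_d_subset[of i] d_c[of i] unfolding E_back F_back by (auto simp: E_def F_def)

text \<open>By cubicity exactly two of the four candidate neighbours of \<open>d i\<close> other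
  than \<open>c i\<close> occur. Three of the six pairs are impossible; the others are R, M and
  L.\<close>

lemma types: "E i \<and> F i \<and> \<not> E (i - 2) \<and> \<not> F (i - 3)
      \<or> E i \<and> E (i - 2) \<and> \<not> F i \<and> \<not> F (i - 3)
      \<or> E (i - 2) \<and> F (i - 3) \<and> \<not> E i \<and> \<not> F i"
proof -
  have sh: "d (i + s) = d (i + t) \<longleftrightarrow> s = t" if "\<bar>s - t\<bar> \<le> 15" for s t
    using c_eq_shift[OF that, of "i + t"] by (simp add: d_eq_iff c_eq_iff)
  have "distinct [d (i - 3), d (i - 2), d (i + 2), d (i + 3)]"
    using sh[of "-3" "-2"] sh[of "-3" 2] sh[of "-3" 3] sh[of "-2" 2] sh[of "-2" 3] sh[of 2 3] by simp
  moreover have "c i \<noteq> d j" for j using d_neq_c by metis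
  moreover have "card {y. (d i, y) \<in> A} = 3" using cubic d_in_V by blast
  ultimately have count: "(if F (i - 3) then 1 else 0) + (if E (i - 2) then 1 else 0)
      + (if E i then 1 else 0) + (if F i then 1 else 0) = (2::nat)"
    unfolding nbrs_d by (simp split: if_splits)
  have w: "(d j, d (j + (s + t))) \<in> A ^^ 2" if "(d j, d (j + s)) \<in> A" "(d (j + s), d (j + s + t)) \<in> A" for j s t
    using that by (auto simp: numeral_2_eq_2 add.assoc)
  \<comment> \<open>Each excluded pair would be a walk of length 2 through \<open>d i\<close> with
    offset 6 or 5, while \<open>d_walk\<close> allows at most 4.\<close>
  have "\<not> (F (i - 3) \<and> F i)" "\<not> (F (i - 3) \<and> E i)" "\<not> (E (i - 2) \<and> F i)"
    using w[of "i - 3" 3 3] d_walk[of "i - 3" 6 2] w[of "i - 3" 3 2] d_walk[of "i - 3" 5 2]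
      w[of "i - 2" 2 3] d_walk[of "i - 2" 5 2]
    unfolding E_def F_def by auto
  with count show ?thesis by (auto split: if_splits)
qed

lemma no_run: "\<not> (E i \<and> E (i + 2) \<and> E (i + 4))"
proof
  assume "E i \<and> E (i + 2) \<and> E (i + 4)"
  then have "(d i, d (i + 6)) \<in> A ^^ 3" by (auto simp: E_def numeral_3_eq_3 add.assoc)
  from d_walk[OF this] show False by simp
qed

lemma adj_c_c: "(c i, c j) \<in> A \<longleftrightarrow> [j = i + 1] (mod int q) \<or> [i = j + 1] (mod int q)"
proof -
  have "(c i, c j) \<in> A \<longleftrightarrow> c j = c (i - 1) \<or> c j = c (i + 1)"
    by (auto simp: nbr_c_iff d_neq_c d_neq_c[symmetric])
  moreover have "[j = i - 1] (mod int q) \<longleftrightarrow> [i = j + 1] (mod int q)"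
    by (simp add: cong_iff_dvd_diff) (metis dvd_minus_iff minus_diff_eq diff_diff_eq2 diff_diff_add)
  ultimately show ?thesis by (auto simp: c_eq_iff)
qed

lemma adj_c_d: "(c i, d j) \<in> A \<longleftrightarrow> [i = j] (mod int q)"
proof -
  have "(c i, d j) \<in> A \<longleftrightarrow> d j = d i"
    by (auto simp: nbr_c_iff d_neq_c d_neq_c[symmetric])
  then show ?thesis by (auto simp: d_eq_iff cong_sym_eq)
qed

lemma adj_d_d: "(d i, d j) \<in> A \<longleftrightarrow> E i \<and> [j = i + 2] (mod int q) \<or> F i \<and> [j = i + 3] (mod int q)
   \<or> E j \<and> [i = j + 2] (mod int q) \<or> F j \<and> [i = j + 3] (mod int q)" (is "_ \<longleftrightarrow> ?R")
proof
  assume a: "(d i, d j) \<in> A"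
  then have "d j \<in> {d (i - 3), d (i - 2), d (i + 2), d (i + 3)}"
    using nbrs_d_subset[OF a] d_neq_c by blast
  moreover have "d j = d (i - s) \<Longrightarrow> d i = d (j + s)" for s
    by (simp add: d_eq_iff cong_iff_dvd_diff) (metis dvd_minus_iff minus_diff_eq diff_diff_eq2 diff_diff_add)
  ultimately consider "d j = d (i + 2)" | "d j = d (i + 3)" | "d i = d (j + 2)" | "d i = d (j + 3)" by blast
  then show ?R
    using a A_sym[OF a] by cases (auto simp: E_def F_def simp flip: d_eq_iff)
next
  assume ?R
  then show "(d i, d j) \<in> A" using A_sym by (auto simp: E_def F_def simp flip: d_eq_iff)
qed

lemma E_cong: "[i = j] (mod int q) \<Longrightarrow> E i = E j"
proof -
  assume "[i = j] (mod int q)"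
  then have "d i = d j" "d (i + 2) = d (j + 2)" by (auto simp: d_eq_iff cong_add_rcancel)
  then show ?thesis by (simp add: E_def)
qed

text \<open>Moving the origin to the start of a block turns \<open>E\<close> and \<open>F\<close>
  into conditions on residues modulo 5. The adjacencies then depend on \<open>q\<close> alone, which
  determines the graph up to isomorphism.\<close>

lemma block_coordinates:
  obtains a b :: "int \<Rightarrow> 'a"
  where "5 dvd q" "V = range a \<union> range b" "\<And>i j. a i \<noteq> b j"
    "\<And>i j. a i = a j \<longleftrightarrow> [i = j] (mod int q)" "\<And>i j. b i = b j \<longleftrightarrow> [i = j] (mod int q)"
    "\<And>i j. (a i, a j) \<in> A \<longleftrightarrow> [j = i + 1] (mod int q) \<or> [i = j + 1] (mod int q)"
    "\<And>i j. (a i, b j) \<in> A \<longleftrightarrow> [i = j] (mod int q)"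
    "\<And>i j. (b i, b j) \<in> A \<longleftrightarrow> i mod 5 \<le> 2 \<and> [j = i + 2] (mod int q) \<or> i mod 5 \<le> 1 \<and> [j = i + 3] (mod int q)
      \<or> j mod 5 \<le> 2 \<and> [i = j + 2] (mod int q) \<or> j mod 5 \<le> 1 \<and> [i = j + 3] (mod int q)"
proof -
  have r: "range (\<lambda>i. f (m + i)) = range f" for f :: "int \<Rightarrow> 'a" and m
    by (metis (no_types, lifting) ext image_image surj_plus)
  have pos: "q > 0" using q_large by simp
  show thesis
  proof (rule periodic_block_pattern[of E F q, OF types no_run E_cong pos])
    fix m assume m: "\<And>i. E (m + i) \<longleftrightarrow> i mod 5 \<le> 2" "\<And>i. F (m + i) \<longleftrightarrow> i mod 5 \<le> 1" "5 dvd q"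
    show thesis
      by (rule that[of "\<lambda>i. c (m + i)" "\<lambda>i. d (m + i)"])
        (simp_all add: V_eq r m d_neq_c d_neq_c[symmetric] c_eq_iff d_eq_iff adj_c_c adj_c_d adj_d_d
          cong_add_lcancel add.assoc)
  qed
qed

end

section \<open>Blocks as Petersen graphs without an edge\<close>

text \<open>Labelling both graphs by one index set \<open>I\<close> makes the vertex map the
  composite of one labelling with the inverse of the other.\<close>

lemma digraph_isoI:
  assumes G: "wf_digraph (with_proj G)" and H: "wf_digraph (with_proj H)"
    and a: "bij_betw a I (pverts G)" and b: "bij_betw b I (pverts H)"
    and adj: "\<And>x y. x \<in> I \<Longrightarrow> y \<in> I \<Longrightarrow> (a x, a y) \<in> parcs G \<longleftrightarrow> (b x, b y) \<in> parcs H"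
  shows "digraph_iso (with_proj G) (with_proj H)"
proof -
  interpret G: pair_wf_digraph G using G by (simp add: wf_digraph_wp_iff)
  interpret H: pair_wf_digraph H using H by (simp add: wf_digraph_wp_iff)
  define h where "h = b \<circ> the_inv_into I a"
  have h: "bij_betw h (pverts G) (pverts H)"
    unfolding h_def using bij_betw_the_inv_into[OF a] b by (rule bij_betw_trans)
  have ha: "h (a x) = b x" if "x \<in> I" for x
    using a that by (simp add: h_def the_inv_into_f_f bij_betw_def)
  have adj': "(x, y) \<in> parcs G \<longleftrightarrow> (h x, h y) \<in> parcs H" if xy: "x \<in> pverts G" "y \<in> pverts G" for x y
  proof -
    obtain x' y' where "x = a x'" "x' \<in> I" "y = a y'" "y' \<in> I"
      using a xy unfolding bij_betw_def by blast
    then show ?thesis by (simp add: adj ha)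
  qed
  \<comment> \<open>Arcs are pairs of vertices, so the vertex map \<open>h\<close> also dictates the
    arc map.\<close>
  define f where "f = \<lparr>iso_verts = h, iso_arcs = map_prod h h, iso_head = snd, iso_tail = fst\<rparr>"
  have inj: "inj_on h (pverts G)" using h by (rule bij_betw_imp_inj_on)
  have "inj_on (map_prod h h) (parcs G)"
    by (rule inj_on_subset[OF map_prod_inj_on[OF inj inj]]) (auto dest: G.wellformed')
  then have "pre_digraph.digraph_isomorphism (with_proj G) f"
    using G inj by (simp add: pre_digraph.digraph_isomorphism_def f_def)
  moreover have "map_prod h h ` parcs G = parcs H"
  proof (intro equalityI subsetI)
    fix e assume "e \<in> map_prod h h ` parcs G"
    then obtain x y where "e = (h x, h y)" "(x, y) \<in> parcs G" by auto
    then show "e \<in> parcs H" using adj'[of x y] G.wellformed'[of x y] by simp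
  next
    fix e assume e: "e \<in> parcs H"
    then have "fst e \<in> h ` pverts G" "snd e \<in> h ` pverts G"
      using h H.arc_fst_in_verts H.arc_snd_in_verts by (auto simp: bij_betw_def)
    then obtain x y where "e = (h x, h y)" "x \<in> pverts G" "y \<in> pverts G" by (auto simp: prod_eq_iff)
    then have "(x, y) \<in> parcs G" "e = map_prod h h (x, y)" using adj'[of x y] e by simp_all
    then show "e \<in> map_prod h h ` parcs G" by blast
  qed
  then have "with_proj H = app_iso f (with_proj G)"
    using h by (intro pre_digraph.equality) (auto simp: f_def bij_betw_def)
  ultimately show ?thesis unfolding digraph_iso_def by blast
qed

text \<open>
  The vertex \<open>(r, False)\<close> of a block is the \<open>r\<close>-th vertex of the path, \<open>(r, True)\<close> is its partner in the
  pentagram. In \<open>K(5, 2)\<close>, the sets \<open>{2r, 2r + 1}\<close> form a 5-cycle, and \<open>{2r + 2, 2r + 4}\<close> is the third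
  neighbour of \<open>{2r, 2r + 1}\<close>, all modulo \<open>5\<close>; the deleted edge joins the ends \<open>r = 0\<close> and \<open>r = 4\<close>.
\<close>

definition block_vertex :: "nat \<times> bool \<Rightarrow> nat set" where
  "block_vertex = (\<lambda>(r, z). if z then {(2 * r + 2) mod 5, (2 * r + 4) mod 5} else {2 * r mod 5, (2 * r + 1) mod 5})"

text \<open>The bounds on \<open>r\<close> and \<open>s\<close> repeat the residue conditions of
  \<open>block_coordinates\<close>. There is no reduction modulo 5, since these edges do not leave
  their block.\<close>

definition block_adj :: "nat \<times> bool \<Rightarrow> nat \<times> bool \<Rightarrow> bool" where
  "block_adj = (\<lambda>(r, z) (s, w).
     if z = w then
       if z then r \<le> 2 \<and> s = r + 2 \<or> r \<le> 1 \<and> s = r + 3 \<or> s \<le> 2 \<and> r = s + 2 \<or> s \<le> 1 \<and> r = s + 3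
       else s = r + 1 \<or> r = s + 1 else r = s)"

lemma less_5: "r < 5 \<longleftrightarrow> r = 0 \<or> r = 1 \<or> r = 2 \<or> r = 3 \<or> r = (4::nat)"
  by auto

lemma block_vertex_subset: "block_vertex x \<subseteq> {..<5}"
  by (auto simp: block_vertex_def split: prod.splits if_splits)

lemma inj_on_block_vertex: "inj_on block_vertex ({..<5} \<times> UNIV)"
  by (auto simp: inj_on_def block_vertex_def less_5 doubleton_eq_iff)

lemma card_block_vertex: "fst x < 5 \<Longrightarrow> card (block_vertex x) = 2"
  by (cases x) (auto simp: block_vertex_def less_5)

text \<open>A check of all 100 pairs: the only further disjoint pair is formed by the two ends of
  the path.\<close>

lemma block_adj_iff:
  assumes "fst x < 5" "fst y < 5"
  shows "block_adj x y \<longleftrightarrow> block_vertex x \<inter> block_vertex y = {}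
    \<and> (x, y) \<noteq> ((0, False), (4, False)) \<and> (x, y) \<noteq> ((4, False), (0, False))"
proof -
  obtain r z s w where x: "x = (r, z)" and y: "y = (s, w)" by (cases x, cases y)
  have "r \<in> {0, 1, 2, 3, 4}" "s \<in> {0, 1, 2, 3, 4}" using assms x y by auto
  then show ?thesis
    unfolding x y by (elim insertE; cases z; cases w; simp add: block_adj_def block_vertex_def)
qed

text \<open>Permutations of the five points act on \<open>petersen\<close> and carry any arc to any
  other, so the labelling with ends \<open>{0, 1}\<close> and \<open>{3, 4}\<close> can be moved to
  an arbitrary arc \<open>(u, v)\<close>.\<close>

lemma petersen_labelling:
  assumes "(u, v) \<in> parcs petersen"
  obtains \<phi> where "bij_betw \<phi> ({..<5} \<times> UNIV) (pverts petersen)" "\<phi> (0, False) = u" "\<phi> (4, False) = v"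
    "\<And>x y. fst x < 5 \<Longrightarrow> fst y < 5 \<Longrightarrow> block_adj x y \<longleftrightarrow> (\<phi> x, \<phi> y) \<in> parcs petersen - {(u, v), (v, u)}"
proof -
  have u: "u \<subseteq> {..<5}" "card u = 2" and v: "v \<subseteq> {..<5}" "card v = 2" and disj: "u \<inter> v = {}"
    using assms by (auto simp: petersen_def Let_def)
  obtain a0 a1 where a: "u = {a0, a1}" "a0 \<noteq> a1" using u(2) by (auto simp: card_2_iff)
  obtain a3 a4 where b: "v = {a3, a4}" "a3 \<noteq> a4" using v(2) by (auto simp: card_2_iff)
  have "card ({..<5} - (u \<union> v)) = 1"
    using u v disj by (subst card_Diff_subset) (auto simp: card_Un_disjoint finite_subset)
  then obtain a2 where "{..<5} - (u \<union> v) = {a2}" by (auto simp: card_1_singleton_iff)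
  then have a2: "a2 < 5" "a2 \<notin> u" "a2 \<notin> v" by auto
  \<comment> \<open>The permutation sends 0, 1 onto \<open>u\<close>, 3, 4 onto \<open>v\<close>,
    and 2 to the one point outside both.\<close>
  define p where "p i = [a0, a1, a2, a3, a4] ! i" for i
  have p: "p 0 = a0" "p 1 = a1" "p (Suc 0) = a1" "p 2 = a2" "p 3 = a3" "p 4 = a4" by (simp_all add: p_def)
  have inj_p: "inj_on p {..<5}"
    unfolding p_def using a b a2 disj by (intro inj_on_nth) auto
  have "{..<5} = {0, 1, 2, 3, 4::nat}" by auto
  then have "p ` {..<5} = {a0, a1, a2, a3, a4}" by (simp add: p)
  then have "p ` {..<5} \<subseteq> {..<5}" using a b a2 u(1) v(1) by auto
  define \<phi> where "\<phi> x = p ` block_vertex x" for x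
  have disjoint: "\<phi> x \<inter> \<phi> y = {} \<longleftrightarrow> block_vertex x \<inter> block_vertex y = {}" for x y
    unfolding \<phi>_def using inj_on_image_Int[OF inj_p block_vertex_subset block_vertex_subset, of x y] by (metis image_is_empty)
  have inj: "inj_on \<phi> ({..<5} \<times> UNIV)"
    unfolding \<phi>_def using inj_on_block_vertex inj_on_image_eq_iff[OF inj_p block_vertex_subset block_vertex_subset] by (auto simp: inj_on_def)
  have \<phi>_in: "\<phi> x \<in> pverts petersen" if "fst x < 5" for x
  proof -
    have "card (\<phi> x) = 2"
      unfolding \<phi>_def using card_image[OF inj_on_subset[OF inj_p block_vertex_subset]] card_block_vertex[OF that] by simp
    moreover have "\<phi> x \<subseteq> {..<5}" unfolding \<phi>_def using \<open>p ` {..<5} \<subseteq> {..<5}\<close> block_vertex_subset by blast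
    ultimately show ?thesis by (simp add: petersen_def Let_def)
  qed
  have verts: "pverts petersen = {A. A \<subseteq> {..<5} \<and> card A = 2}" by (simp add: petersen_def Let_def)
  \<comment> \<open>Surjectivity by counting: there are 10 labels and 10 two-element subsets of a
    5-set.\<close>
  have "card (pverts petersen) = 10" unfolding verts by (subst n_subsets) (auto simp: choose_two)
  moreover have "finite (pverts petersen)" unfolding verts by (rule finite_subset[of _ "Pow {..<5}"]) auto
  moreover have "card (\<phi> ` ({..<5} \<times> UNIV)) = 10" using card_image[OF inj] by (simp add: card_cartesian_product)
  ultimately have "\<phi> ` ({..<5} \<times> UNIV) = pverts petersen"
    using \<phi>_in by (intro card_subset_eq) auto
  with inj have bij: "bij_betw \<phi> ({..<5} \<times> UNIV) (pverts petersen)" by (simp add: bij_betw_def)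
  have ends: "\<phi> (0, False) = u" "\<phi> (4, False) = v"
    by (auto simp: \<phi>_def block_vertex_def p a b)
  show thesis
  proof (rule that[OF bij ends])
    fix x y :: "nat \<times> bool" assume xy: "fst x < 5" "fst y < 5"
    have eq: "\<phi> z = \<phi> w \<longleftrightarrow> z = w" if "fst z < 5" "fst w < 5" for z w
      using inj_on_eq_iff[OF inj, of z w] that by (cases z; cases w) auto
    have "\<phi> x = u \<longleftrightarrow> x = (0, False)" "\<phi> y = u \<longleftrightarrow> y = (0, False)"
      "\<phi> x = v \<longleftrightarrow> x = (4, False)" "\<phi> y = v \<longleftrightarrow> y = (4, False)"
      using eq xy unfolding ends[symmetric] by auto
    moreover have "(\<phi> x, \<phi> y) \<in> parcs petersen \<longleftrightarrow> block_vertex x \<inter> block_vertex y = {}"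
      using \<phi>_in xy disjoint by (auto simp: petersen_def Let_def)
    ultimately show "block_adj x y \<longleftrightarrow> (\<phi> x, \<phi> y) \<in> parcs petersen - {(u, v), (v, u)}"
      unfolding block_adj_iff[OF xy] by auto
  qed
qed

section \<open>Block coordinates and the isomorphism\<close>

lemma wf_F_3_5: 
  assumes uv: "(u, v) \<in> parcs petersen"
  shows "wf_digraph (with_proj (F_3_5 u v q))"
proof -
  have "u \<in> pverts petersen" "v \<in> pverts petersen" "parcs petersen \<subseteq> pverts petersen \<times> pverts petersen"
    using uv by (auto simp: petersen_def Let_def)
  then show ?thesis
    by unfold_locales (auto simp: F_3_5_def Let_def)
qed

text \<open>Both numbers lie below \<open>5 * j\<close>, so congruence is equality, and division by
  5 recovers the block \<open>k\<close> and the position \<open>r\<close>.\<close>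

lemma cong_coordinates:
  assumes "k < j" "k' < j" "r < 5" "r' < (5::nat)"
  shows "[int (5 * k' + r') = int (5 * k + r)] (mod int (5 * j)) \<longleftrightarrow> k' = k \<and> r' = r"
proof -
  have "5 * k + r < 5 * j" "5 * k' + r' < 5 * j" using assms by linarith+
  then have "[int (5 * k' + r') = int (5 * k + r)] (mod int (5 * j)) \<longleftrightarrow> 5 * k' + r' = 5 * k + r"
    unfolding cong_int_iff by (simp add: cong_def)
  also have "\<dots> \<longleftrightarrow> k' = k \<and> r' = r"
  proof
    assume "5 * k' + r' = 5 * k + r"
    then have "(5 * k' + r') div 5 = (5 * k + r) div 5" "(5 * k' + r') mod 5 = (5 * k + r) mod 5" by simp_all
    then show "k' = k \<and> r' = r" using assms by simp
  qed simp
  finally show ?thesis .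
qed

text \<open>The successor stays in its block except at position 4, where it passes to position 0 of
  the next block, cyclically. This exception yields the linking edges.\<close>

lemma cong_coordinates_Suc:
  assumes "k < j" "k' < j" "r < 5" "r' < (5::nat)"
  shows "[int (5 * k' + r') = int (5 * k + r) + 1] (mod int (5 * j)) \<longleftrightarrow>
    k' = k \<and> r' = r + 1 \<or> r = 4 \<and> r' = 0 \<and> k' = Suc k mod j"
proof (cases "r = 4")
  case False
  have *: "int (5 * k + r) + 1 = int (5 * k + (r + 1))" by simp
  show ?thesis unfolding * using cong_coordinates[of k j k' "r + 1" r'] assms False by simp
next
  case True
  have "[int (5 * k + r) + 1 = int (5 * (Suc k mod j) + 0)] (mod int (5 * j))"
  proof -
    have "int (5 * k + r) + 1 = int (5 * Suc k)" using True by simp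
    moreover have "[5 * Suc k = 5 * (Suc k mod j)] (mod 5 * j)"
      by (rule cong_cmult_leftI) simp
    ultimately show ?thesis by (simp only: cong_int_iff add_0_right)
  qed
  then have "[int (5 * k' + r') = int (5 * k + r) + 1] (mod int (5 * j)) \<longleftrightarrow>
     [int (5 * k' + r') = int (5 * (Suc k mod j) + 0)] (mod int (5 * j))"
    using cong_trans cong_sym by blast
  also have "\<dots> \<longleftrightarrow> k' = Suc k mod j \<and> r' = 0" using assms by (intro cong_coordinates) auto
  finally show ?thesis using True assms by auto
qed

lemma iso_F_3_5:
  fixes G :: "'a pair_pre_digraph" and a b :: "int \<Rightarrow> 'a"
  assumes wf: "wf_digraph (with_proj G)" and "5 dvd q" "q > 0"
    and sym: "\<And>x y. (x, y) \<in> parcs G \<Longrightarrow> (y, x) \<in> parcs G"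
    and V: "pverts G = range a \<union> range b" and ab: "\<And>i j. a i \<noteq> b j"
    and a_eq: "\<And>i j. a i = a j \<longleftrightarrow> [i = j] (mod int q)" and b_eq: "\<And>i j. b i = b j \<longleftrightarrow> [i = j] (mod int q)"
    and aa: "\<And>i j. (a i, a j) \<in> parcs G \<longleftrightarrow> [j = i + 1] (mod int q) \<or> [i = j + 1] (mod int q)"
    and adj_ab: "\<And>i j. (a i, b j) \<in> parcs G \<longleftrightarrow> [i = j] (mod int q)"
    and bb: "\<And>i j. (b i, b j) \<in> parcs G \<longleftrightarrow> i mod 5 \<le> 2 \<and> [j = i + 2] (mod int q) \<or> i mod 5 \<le> 1 \<and> [j = i + 3] (mod int q)
      \<or> j mod 5 \<le> 2 \<and> [i = j + 2] (mod int q) \<or> j mod 5 \<le> 1 \<and> [i = j + 3] (mod int q)"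
    and uv: "(u, v) \<in> parcs petersen"
  shows "digraph_iso (with_proj G) (with_proj (F_3_5 u v q))"
proof -
  obtain j where q: "q = 5 * j" using \<open>5 dvd q\<close> by blast
  obtain \<phi> where \<phi>: "bij_betw \<phi> ({..<5} \<times> UNIV) (pverts petersen)" "\<phi> (0, False) = u" "\<phi> (4, False) = v"
    "\<And>x y. fst x < 5 \<Longrightarrow> fst y < 5 \<Longrightarrow> block_adj x y \<longleftrightarrow> (\<phi> x, \<phi> y) \<in> parcs petersen - {(u, v), (v, u)}"
    using petersen_labelling[OF uv] by metis
  \<comment> \<open>A label consists of a block, a position in it, and a flag choosing between the
    path and the pentagram.\<close>
  define I where "I = {..<j} \<times> {..<5::nat} \<times> (UNIV :: bool set)"
  define \<alpha> where "\<alpha> = (\<lambda>(k, r, z). (if z then b else a) (int (5 * k + r)))"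
  define \<beta> where "\<beta> = map_prod (\<lambda>k::nat. k) \<phi>"
  note cong = cong_coordinates[of _ j] cong_coordinates_Suc[of _ j]
  show ?thesis
  proof (rule digraph_isoI[of _ _ \<alpha> I \<beta>])
    show "wf_digraph (with_proj G)" by fact
    show "wf_digraph (with_proj (F_3_5 u v q))" using uv by (rule wf_F_3_5)
    have "inj_on \<alpha> I"
      using cong(1) by (auto simp: inj_on_def I_def \<alpha>_def a_eq b_eq ab ab[symmetric] q simp del: of_nat_add of_nat_mult)
    moreover have "\<alpha> ` I = pverts G"
    proof -
      \<comment> \<open>Reduction modulo \<open>q\<close> followed by division by 5 finds a label
        for every index.\<close>
      have "f i \<in> (\<lambda>(k, r). f (int (5 * k + r))) ` ({..<j} \<times> {..<5})"
        if "\<And>i j. f i = f j \<longleftrightarrow> [i = j] (mod int q)" for f :: "int \<Rightarrow> 'a" and i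
      proof -
        define n where "n = nat (i mod int q)"
        have n: "int n = i mod int q" "n < q" using \<open>q > 0\<close> by (simp_all add: n_def nat_less_iff)
        have "f i = f (int n)" unfolding that n by (simp add: cong_def)
        then have "f i = (\<lambda>(k, r). f (int (5 * k + r))) (n div 5, n mod 5)"
          by (simp only: prod.case mult_div_mod_eq)
        moreover have "n div 5 < j" using n(2) q by auto
        ultimately show ?thesis by (intro image_eqI[of _ _ "(n div 5, n mod 5)"]) auto
      qed
      from this[of a, OF a_eq] this[of b, OF b_eq] show ?thesis
        unfolding V by (fastforce simp: \<alpha>_def I_def image_iff)
    qed
    ultimately show "bij_betw \<alpha> I (pverts G)" by (simp add: bij_betw_def)
    show "bij_betw \<beta> I (pverts (F_3_5 u v q))"
      using \<phi>(1) unfolding \<beta>_def I_def F_3_5_def q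
      by (auto simp: bij_betw_def Let_def intro!: map_prod_inj_on map_prod_surj_on)
  next
    fix x y assume "x \<in> I" "y \<in> I"
    then obtain k r z k' r' z' where x: "x = (k, r, z)" "k < j" "r < 5" and y: "y = (k', r', z')" "k' < j" "r' < 5"
      by (auto simp: I_def)
    \<comment> \<open>From positions up to 2 and 1, steps of 2 and 3 stay within the block, so
      pentagram edges never cross blocks or wrap around.\<close>
    have shift: "int s \<le> 2 \<and> [int (5 * l' + s') = int (5 * l + s) + 2] (mod int q) \<longleftrightarrow> s \<le> 2 \<and> l' = l \<and> s' = s + 2"
      "int s \<le> 1 \<and> [int (5 * l' + s') = int (5 * l + s) + 3] (mod int q) \<longleftrightarrow> s \<le> 1 \<and> l' = l \<and> s' = s + 3"
      if "l < j" "l' < j" "s' < 5" for l s l' s'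
    proof -
      have *: "int (5 * l + s) + 2 = int (5 * l + (s + 2))" "int (5 * l + s) + 3 = int (5 * l + (s + 3))" by simp_all
      show "int s \<le> 2 \<and> [int (5 * l' + s') = int (5 * l + s) + 2] (mod int q) \<longleftrightarrow> s \<le> 2 \<and> l' = l \<and> s' = s + 2"
        unfolding * q using cong(1)[of l l' "s + 2" s'] that by (simp del: of_nat_add of_nat_mult) auto
      show "int s \<le> 1 \<and> [int (5 * l' + s') = int (5 * l + s) + 3] (mod int q) \<longleftrightarrow> s \<le> 1 \<and> l' = l \<and> s' = s + 3"
        unfolding * q using cong(1)[of l l' "s + 3" s'] that by (simp del: of_nat_add of_nat_mult) auto
    qed
    have mod5: "int (5 * l + s) mod 5 = int s" if "s < 5" for l s using that by simp
    have bb': "(b (int (5 * k + r)), b (int (5 * k' + r'))) \<in> parcs G \<longleftrightarrow>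
      k' = k \<and> (r \<le> 2 \<and> r' = r + 2 \<or> r \<le> 1 \<and> r' = r + 3 \<or> r' \<le> 2 \<and> r = r' + 2 \<or> r' \<le> 1 \<and> r = r' + 3)"
      unfolding bb mod5[OF x(3)] mod5[OF y(3)]
        shift[OF x(2) y(2,3)] shift[OF y(2) x(2,3)] by auto
    \<comment> \<open>Edges inside a block follow \<open>block_adj\<close>. The others join two
      consecutive paths and arise only when both flags are \<open>False\<close>.\<close>
    have "(\<alpha> x, \<alpha> y) \<in> parcs G \<longleftrightarrow> k = k' \<and> block_adj (r, z) (r', z')
        \<or> k' = Suc k mod j \<and> (r, z) = (4, False) \<and> (r', z') = (0, False)
        \<or> k = Suc k' mod j \<and> (r', z') = (4, False) \<and> (r, z) = (0, False)"
    proof (cases z; cases z')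
      assume zz: "z" "z'"
      show ?thesis
        using bb' x(2,3) y(2,3) unfolding x(1) y(1)
        by (auto simp: \<alpha>_def zz block_adj_def simp del: of_nat_add of_nat_mult)
    next
      assume zz: "\<not> z" "\<not> z'"
      show ?thesis
        using cong(2)[of k k' r r'] cong(2)[of k' k r' r] x y zz
        by (auto simp: \<alpha>_def aa q block_adj_def)
    next
      assume zz: "\<not> z" "z'"
      show ?thesis
        using cong(1)[of k k' r r'] cong(1)[of k' k r' r] x y zz
        by (auto simp: \<alpha>_def adj_ab q block_adj_def)
    next
      assume zz: "z" "\<not> z'"
      have "(b i, a j) \<in> parcs G \<longleftrightarrow> [j = i] (mod int q)" for i j using sym adj_ab by blast
      then show ?thesis
        using cong(1)[of k k' r r'] cong(1)[of k' k r' r] x y zz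
        by (auto simp: \<alpha>_def q block_adj_def)
    qed
    also have "\<dots> \<longleftrightarrow> (\<beta> x, \<beta> y) \<in> parcs (F_3_5 u v q)"
    proof -
      have eq: "\<phi> w = \<phi> w' \<longleftrightarrow> w = w'" if "fst w < 5" "fst w' < 5" for w w'
        using inj_on_eq_iff[OF bij_betw_imp_inj_on[OF \<phi>(1)], of w w'] that by (cases w; cases w') auto
      \<comment> \<open>In each copy, \<open>u\<close> is position 0 and \<open>v\<close> is
        position 4 of the path, so the links from \<open>v\<close> to the next \<open>u\<close>
        match the edges between consecutive blocks.\<close>
      have uv_iff: "\<phi> w = u \<longleftrightarrow> w = (0, False)" "\<phi> w = v \<longleftrightarrow> w = (4, False)" if "fst w < 5" for w
        using eq that unfolding \<phi>(2,3)[symmetric] by auto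
      have "(\<beta> x, \<beta> y) \<in> parcs (F_3_5 u v q) \<longleftrightarrow>
          k = k' \<and> (\<phi> (r, z), \<phi> (r', z')) \<in> parcs petersen - {(u, v), (v, u)}
        \<or> k' = Suc k mod j \<and> \<phi> (r, z) = v \<and> \<phi> (r', z') = u
        \<or> k = Suc k' mod j \<and> \<phi> (r', z') = v \<and> \<phi> (r, z) = u"
        unfolding \<beta>_def x y F_3_5_def q using x(2) y(2) by (auto simp: Let_def)
      then show ?thesis
        using \<phi>(4)[of "(r, z)" "(r', z')"] uv_iff[of "(r, z)"] uv_iff[of "(r', z')"] x(3) y(3) by auto
    qed
    finally show "(\<alpha> x, \<alpha> y) \<in> parcs G \<longleftrightarrow> (\<beta> x, \<beta> y) \<in> parcs (F_3_5 u v q)" .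
  qed
qed

section \<open>From equatorial graphs to the cycle setting\<close>

lemma (in pair_graph) cubic_isometric_cycle_if_equatorial:
  assumes eq: "equatorial_3_5 G" and reg: "regular 3 G"
  obtains c where "cubic_isometric_cycle (pverts G) (parcs G) c (equator G)"
proof -
  \<comment> \<open>The order is prescribed as a real number, so it simplifies to twice the equator
    before divisibility by 5 is known.\<close>
  have girth: "girth G = 5" and card: "card (pverts G) = 2 * equator G" and large: "equator G > 15"
    using eq by (auto simp: equatorial_3_5_def)
  obtain C where iso: "isometric_cycle G C" and len: "length C = equator G"
    using equator_attained[OF pair_graph girth] by blast
  from iso have "graph_cycle G C" by (simp add: isometric_cycle_def)
  then obtain c where c_eq: "\<And>i j. c i = c j \<longleftrightarrow> [i = j] (mod int (length C))"
    and C: "set C = range (\<lambda>i. (c i, c (i + 1)))" "set C \<subseteq> parcs G" "fst ` set C = range c"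
    by (rule graph_cycle_param[OF pair_wf_digraph]) (use that in blast)
  have girth': "girth G > 3" "girth G > 4" using girth by simp_all
  have "cubic_isometric_cycle (pverts G) (parcs G) c (equator G)"
  proof
    show "\<exists>t. \<bar>t\<bar> \<le> int n \<and> [j = i + t] (mod int (equator G))" if "(c i, c j) \<in> parcs G ^^ n" for i j n
      using isometric_cycle_walk[OF pair_wf_digraph iso C(1,3) c_eq that] len by simp
    show "parcs G \<subseteq> pverts G \<times> pverts G" using wellformed' by auto
    show "card {y. (x, y) \<in> parcs G} = 3" if "x \<in> pverts G" for x
      using reg that by (simp add: regular_def out_degree_with_proj)
    show "(c i, c (i + 1)) \<in> parcs G" for i using C(1,2) by blast
    show "(x, x) \<notin> parcs G" for x using no_loops' by blast
    show "(z, x) \<notin> parcs G" if "(x, y) \<in> parcs G" "(y, z) \<in> parcs G" for x y z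
      using girth_no_triangle[OF pair_graph girth'(1)] that by blast
    show "w = y \<or> x = z" if "(w, x) \<in> parcs G" "(x, y) \<in> parcs G" "(y, z) \<in> parcs G" "(z, w) \<in> parcs G"
      for w x y z
      using girth_no_square[OF pair_graph girth'(2)] that by blast
  qed (use pair_finite_verts card large c_eq len arcs_symmetric in auto)
  then show thesis by (rule that)
qed

theorem theorem31:
  fixes G :: "'a pair_pre_digraph" and q :: nat
  assumes "equatorial_3_5 G"
    and "regular 3 G"
    and "equator G = q"
  shows "[q = 0] (mod 5) \<and>
    (\<forall>u v. (u, v) \<in> parcs petersen \<longrightarrow>
       digraph_iso (with_proj G) (with_proj (F_3_5 u v q)))"
proof -
  interpret pair_graph G using assms(1) by (simp add: equatorial_3_5_def)
  have wf: "wf_digraph (with_proj G)" using pair_wf_digraph by (simp add: wf_digraph_wp_iff)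
  obtain c where "cubic_isometric_cycle (pverts G) (parcs G) c q"
    using cubic_isometric_cycle_if_equatorial[OF assms(1,2)] assms(3) by metis
  then interpret cubic_isometric_cycle "pverts G" "parcs G" c q .
  show ?thesis
  proof (rule block_coordinates)
    fix a b
    assume *: "5 dvd q" "pverts G = range a \<union> range b" "\<And>i j. a i \<noteq> b j"
      "\<And>i j. a i = a j \<longleftrightarrow> [i = j] (mod int q)" "\<And>i j. b i = b j \<longleftrightarrow> [i = j] (mod int q)"
      "\<And>i j. (a i, a j) \<in> parcs G \<longleftrightarrow> [j = i + 1] (mod int q) \<or> [i = j + 1] (mod int q)"
      "\<And>i j. (a i, b j) \<in> parcs G \<longleftrightarrow> [i = j] (mod int q)"
      "\<And>i j. (b i, b j) \<in> parcs G \<longleftrightarrow> i mod 5 \<le> 2 \<and> [j = i + 2] (mod int q) \<or> i mod 5 \<le> 1 \<and> [j = i + 3] (mod int q)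
        \<or> j mod 5 \<le> 2 \<and> [i = j + 2] (mod int q) \<or> j mod 5 \<le> 1 \<and> [i = j + 3] (mod int q)"
    have "q > 0" using q_large by simp
    from iso_F_3_5[OF wf *(1) this arcs_symmetric *(2-8)] *(1) show ?thesis
      by (simp add: cong_0_iff)
  qed
qed

end
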